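(* Assume that $T_{\text{s}} \le x_{\min,k} \le T_{\text{r},k}$ for all $k$ (the second inequality being understood for the room temperatures $T_{\text{r},k}$ of feasible trajectories). Let $0<w_{\text{lim}}\le 1$. Then the following two optimization problems, in the decision variables $(u_k,r_{\text{u},k},r_{\text{d},k})_{k=0}^{N_1-1}$ with $r_{\text{u},k},r_{\text{d},k}\ge 0$, are equivalent. Problem (P), robust reserve scheduling: minimize $$\sum_{k=0}^{N_1-1}\big[c_k f(u_k)-\lambda_k(R_{\text{d},k}+R_{\text{u},k})\big]$$ subject to (a) $u_{\min}\le u_k+\Delta u_k\le u_{\max}$ for all $w_k\in[-1,1]$ and all $k$; (b) for all sequences $(w_k)$ with $w_k\in[-w_{\text{lim}},w_{\text{lim}}]$, the trajectory started at $x_0$ and given by $x_{k+1}=Ax_k+B_uT_{\text{s}}(u_k+\Delta u_k)+B_{xu}x_k(u_k+\Delta u_k)+B_vv_k$ satisfies $x_{\min,k}\le x_k\le x_{\max,k}$ for all $k$. Problem (Q): minimize the same objective subject to (a') $u_{\min}\le u_k-r_{\text{d},k}$ and $u_k+r_{\text{u},k}\le u_{\max}$ for all $k$; (b') the two trajectories started at $\overline x_0=\underline x_0=x_0$ and given by $$\overline x_{k+1}=A\overline x_k+B_uT_{\text{s}}\, f^{-1}(P_k-w_{\text{lim}}R_{\text{u},k})+B_{xu}\overline x_k\, f^{-1}(P_k-w_{\text{lim}}R_{\text{u},k})+B_vv_k,$$ $$\underline x_{k+1}=A\underline x_k+B_uT_{\text{s}}\, f^{-1}(P_k+w_{\text{lim}}R_{\text{d},k})+B_{xu}\underline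 x_k\, f^{-1}(P_k+w_{\text{lim}}R_{\text{d},k})+B_vv_k$$ satisfy $x_{\min,k}\le\underline x_k$ and $\overline x_k\le x_{\max,k}$ for all $k$.
   Context: "Equivalent" means that the two problems have the same objective function and the same set of feasible decisions $(u_k,r_{\text{u},k},r_{\text{d},k})_k$. Fan curve: $f(u)=\alpha_3u^3+\alpha_2u^2+\alpha_1u+\alpha_0$ with $\alpha_3=2588.2$, $\alpha_2=-1458.0$, $\alpha_1=630.9$, $\alpha_0=28.7$. This is a strictly increasing bijection of $\mathbb{R}$, with inverse $f^{-1}$. It maps air mass flow rate $u$ to fan power. Notation: $P_k=f(u_k)$; $r_{\text{u},k},r_{\text{d},k}\ge0$ are thermal reserve capacities (maximal changes of air flow); $R_{\text{u},k}=f(u_k)-f(u_k-r_{\text{d},k})$ and $R_{\text{d},k}=f(u_k+r_{\text{u},k})-f(u_k)$. For a regulation signal value $w_k\in[-1,1]$, $R_k=w_kR_{\text{u},k}$ if $w_k<0$ and $R_k=w_kR_{\text{d},k}$ if $w_k\ge0$; and $\Delta u_k=f^{-1}(P_k+R_k)-u_k$. Flow bounds: $u_{\min}=h(20)$ and $u_{\max}=h(80)$, where $h(N)=0.0133N+0.0606$, i.e. $u_{\min}=0.3266$, $u_{\max}=1.1246$. Building model: the state is $x_k=(T_{\text{r},k},T_{\text{m},k})^\top\in\mathbb{R}^2$ (room temperature and thermal mass temperature), $v_k\in\mathbb{R}^3$ is a given disturbance, and $$A=\begin{bmatrix} a_{11} & a_{12} \\ a_{21} & a_{22} \end{bmatrix},\quad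 B_u=\begin{bmatrix} b \\ 0 \end{bmatrix},\quad B_{xu}=\begin{bmatrix} -b & 0 \\ 0 & 0 \end{bmatrix},\quad B_v=\begin{bmatrix} d_{11} & d_{12} & d_{13} \\ 0 & 0 & 0 \end{bmatrix}.$$ The parameters are one of the two identified sets: (i) $a_{11}=0.8665$, $a_{12}=0.0918$, $a_{21}=0.0374$, $a_{22}=0.9703$, $b=0.2996$, $d_{11}=0.0230$, $d_{12}=2.016\cdot10^{-4}$, $d_{13}=1.424\cdot10^{-4}$; (ii) $a_{11}=0.6344$, $a_{12}=0.2661$, $a_{21}=0.1021$, $a_{22}=0.9170$, $b=0.4716$, $d_{11}=0.0405$, $d_{12}=0.0028$, $d_{13}=3.3686\cdot10^{-4}$. $T_{\text{s}}$ is the constant supply air temperature. $c_k,\lambda_k$ are given real prices and $x_0$ is a given initial state. The bounds $x_{\min,k},x_{\max,k}\in\mathbb{R}$ constrain only the first component (room temperature) of the state; e.g. $x_{\min,k}\le x_k$ means $x_{\min,k}\le T_{\text{r},k}$. Dynamics are imposed for $k=0,\dots,N_1-1$ and temperature constraints for $k=0,\dots,N_1$; all other "for all $k$" refer to $k=0,\dots,N_1-1$. *)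

theory Defs
  imports "HOL-Analysis.Analysis"
begin

definition fan_power :: "real \<Rightarrow> real" where
  "fan_power u = 2588.2 * u ^ 3 - 1458.0 * u ^ 2 + 630.9 * u + 28.7"

text \<open>The fan curve is a bijection of the reals, so \<open>inv fan_power\<close> is its genuine inverse.\<close>

abbreviation fan_flow :: "real \<Rightarrow> real" where
  "fan_flow \<equiv> inv fan_power"

definition flow_of_speed :: "real \<Rightarrow> real" where
  "flow_of_speed n = 0.0133 * n + 0.0606"

definition u_min :: real where "u_min = flow_of_speed 20"

definition u_max :: real where "u_max = flow_of_speed 80"

text \<open>Electrical up-reserve comes from the thermal down-reserve \<open>rd\<close>, and vice versa.\<close>

definition R_up :: "real \<Rightarrow> real \<Rightarrow> real" where
  "R_up u rd = fan_power u - fan_power (u - rd)"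

definition R_down :: "real \<Rightarrow> real \<Rightarrow> real" where
  "R_down u ru = fan_power (u + ru) - fan_power u"

definition reserve_request :: "real \<Rightarrow> real \<Rightarrow> real \<Rightarrow> real \<Rightarrow> real" where
  "reserve_request u ru rd w = (if w < 0 then w * R_up u rd else w * R_down u ru)"

definition flow_change :: "real \<Rightarrow> real \<Rightarrow> real \<Rightarrow> real \<Rightarrow> real" where
  "flow_change u ru rd w = fan_flow (fan_power u + reserve_request u ru rd w) - u"

record building =
  a11 :: real
  a12 :: real
  a21 :: real
  a22 :: real
  bcoef :: real
  d11 :: real
  d12 :: real
  d13 :: real

definition building_i :: building where
  "building_i = \<lparr>a11 = 0.8665, a12 = 0.0918, a21 = 0.0374, a22 = 0.9703, bcoef = 0.2996,
     d11 = 0.0230, d12 = 2.016 / 10 ^ 4, d13 = 1.424 / 10 ^ 4\<rparr>"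

definition building_ii :: building where
  "building_ii = \<lparr>a11 = 0.6344, a12 = 0.2661, a21 = 0.1021, a22 = 0.9170, bcoef = 0.4716,
     d11 = 0.0405, d12 = 0.0028, d13 = 3.3686 / 10 ^ 4\<rparr>"

definition mat_A :: "building \<Rightarrow> real^2^2" where
  "mat_A m = vector [vector [a11 m, a12 m], vector [a21 m, a22 m]]"

definition vec_Bu :: "building \<Rightarrow> real^2" where
  "vec_Bu m = vector [bcoef m, 0]"

definition mat_Bxu :: "building \<Rightarrow> real^2^2" where
  "mat_Bxu m = vector [vector [- bcoef m, 0], vector [0, 0]]"

definition mat_Bv :: "building \<Rightarrow> real^3^2" where
  "mat_Bv m = vector [vector [d11 m, d12 m, d13 m], vector [0, 0, 0]]"

record problem_data =
  bmodel :: building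
  horizon :: nat
  supply_temp :: real
  disturbance :: "nat \<Rightarrow> real^3"
  init_state :: "real^2"
  price :: "nat \<Rightarrow> real"
  reserve_price :: "nat \<Rightarrow> real"
  x_min :: "nat \<Rightarrow> real"
  x_max :: "nat \<Rightarrow> real"
  w_lim :: real

text \<open>The state trajectory under a sequence \<open>q\<close> of applied air flows.\<close>

primrec trajectory :: "problem_data \<Rightarrow> (nat \<Rightarrow> real) \<Rightarrow> nat \<Rightarrow> real^2" where
  "trajectory D q 0 = init_state D"
| "trajectory D q (Suc k) =
     mat_A (bmodel D) *v trajectory D q k
     + (supply_temp D * q k) *\<^sub>R vec_Bu (bmodel D)
     + q k *\<^sub>R (mat_Bxu (bmodel D) *v trajectory D q k)
     + mat_Bv (bmodel D) *v disturbance D k"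

abbreviation room_temp :: "real^2 \<Rightarrow> real" where
  "room_temp x \<equiv> x $ 1"

datatype 'd opt_problem =
  Opt_Problem (objective: "'d \<Rightarrow> real") (feasible_set: "'d set")

definition equivalent_problems :: "'d opt_problem \<Rightarrow> 'd opt_problem \<Rightarrow> bool" where
  "equivalent_problems P Q \<longleftrightarrow> objective P = objective Q \<and> feasible_set P = feasible_set Q"

text \<open>A decision is the triple of sequences \<open>(u, ru, rd)\<close>. The extensional function space
  makes such functions correspond exactly to the finite sequences of length \<open>horizon D\<close>.\<close>

type_synonym decision = "(nat \<Rightarrow> real) \<times> (nat \<Rightarrow> real) \<times> (nat \<Rightarrow> real)"

definition decisions :: "problem_data \<Rightarrow> decision set" where
  "decisions D = ({..<horizon D} \<rightarrow>\<^sub>E UNIV)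
     \<times> ({..<horizon D} \<rightarrow>\<^sub>E {0..}) \<times> ({..<horizon D} \<rightarrow>\<^sub>E {0..})"

definition cost :: "problem_data \<Rightarrow> decision \<Rightarrow> real" where
  "cost D = (\<lambda>(u, ru, rd). \<Sum>k<horizon D.
     price D k * fan_power (u k)
     - reserve_price D k * (R_down (u k) (ru k) + R_up (u k) (rd k)))"

definition robust_trajectory ::
    "problem_data \<Rightarrow> decision \<Rightarrow> (nat \<Rightarrow> real) \<Rightarrow> nat \<Rightarrow> real^2" where
  "robust_trajectory D = (\<lambda>(u, ru, rd) w.
     trajectory D (\<lambda>k. u k + flow_change (u k) (ru k) (rd k) (w k)))"

definition signals :: "problem_data \<Rightarrow> (nat \<Rightarrow> real) set" where
  "signals D = {w. \<forall>k<horizon D. w k \<in> {- w_lim D..w_lim D}}"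

definition upper_trajectory :: "problem_data \<Rightarrow> decision \<Rightarrow> nat \<Rightarrow> real^2" where
  "upper_trajectory D = (\<lambda>(u, ru, rd).
     trajectory D (\<lambda>k. fan_flow (fan_power (u k) - w_lim D * R_up (u k) (rd k))))"

definition lower_trajectory :: "problem_data \<Rightarrow> decision \<Rightarrow> nat \<Rightarrow> real^2" where
  "lower_trajectory D = (\<lambda>(u, ru, rd).
     trajectory D (\<lambda>k. fan_flow (fan_power (u k) + w_lim D * R_down (u k) (ru k))))"

text \<open>Flow bounds are required for signals in \<open>[-1, 1]\<close>, temperature bounds only for signals
  in \<open>[-w_lim, w_lim]\<close>.\<close>

definition problem_P :: "problem_data \<Rightarrow> decision opt_problem" where
  "problem_P D = Opt_Problem (cost D)
     {(u, ru, rd) \<in> decisions D.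
        (\<forall>k<horizon D. \<forall>w\<in>{-1..1}.
           u_min \<le> u k + flow_change (u k) (ru k) (rd k) w
           \<and> u k + flow_change (u k) (ru k) (rd k) w \<le> u_max)
        \<and> (\<forall>w\<in>signals D. \<forall>k\<le>horizon D.
             x_min D k \<le> room_temp (robust_trajectory D (u, ru, rd) w k)
             \<and> room_temp (robust_trajectory D (u, ru, rd) w k) \<le> x_max D k)}"

definition problem_Q :: "problem_data \<Rightarrow> decision opt_problem" where
  "problem_Q D = Opt_Problem (cost D)
     {(u, ru, rd) \<in> decisions D.
        (\<forall>k<horizon D. u_min \<le> u k - rd k \<and> u k + ru k \<le> u_max)
        \<and> (\<forall>k\<le>horizon D.
             x_min D k \<le> room_temp (lower_trajectory D (u, ru, rd) k)
             \<and> room_temp (upper_trajectory D (u, ru, rd) k) \<le> x_max D k)}"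

end

theory Submission
  imports Defs
begin

text \<open>
  The fan curve increases with slope at least 1, so it is invertible and the applied air flow is an
  increasing function of the regulation signal. Since the room temperature obeys
  \<open>T' = (a11 - b q) T + a12 M + b q T\<^sub>s + \<dots>\<close> with \<open>a11 - b q \<ge> 0\<close> for \<open>q \<le> u_max\<close>, a step is monotone
  in the state, and it is antitone in the flow \<open>q\<close> while \<open>T \<ge> T\<^sub>s\<close>. Hence the constant signals
  \<open>w_lim\<close> and \<open>- w_lim\<close> give the coldest and the warmest trajectory. The temperatures stay above
  \<open>T\<^sub>s\<close> because already the coldest one respects \<open>x_min\<close>.
\<close>

text \<open>The difference quotient of the cubic is a quadratic polynomial in \<open>x\<close> and
  \<open>y\<close> whose minimum exceeds 1. The quantitative bound gives surjectivity as well as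
  monotonicity.\<close>

lemma fan_power_slope_ge_1:
  assumes "x \<le> y"
  shows "y - x \<le> fan_power y - fan_power x"
proof -
  let ?s = "x + y"
  \<comment> \<open>The left side is the difference quotient minus 1, hence 629.9 = 630.9 - 1.
    Squares are completed via x^2 + xy + y^2 = (x - y)^2/4 + 3(x + y)^2/4, with 7764.6 = 3 *
    2588.2.\<close>
  have "2588.2 * (x\<^sup>2 + x * y + y\<^sup>2) - 1458 * ?s + 629.9
      = 2588.2 / 4 * (x - y)\<^sup>2 + 7764.6 / 4 * (?s - 2916 / 7764.6)\<^sup>2 + (629.9 - 1458\<^sup>2 / 7764.6)"
    by (simp add: power2_eq_square field_simps)
  also have "\<dots> \<ge> 0" by (simp add: power2_eq_square)
  finally have "0 \<le> (y - x) * (2588.2 * (x\<^sup>2 + x * y + y\<^sup>2) - 1458 * ?s + 629.9)"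
    using assms by simp
  then show ?thesis
    by (simp add: fan_power_def power2_eq_square power3_eq_cube field_simps)
qed

lemma strict_mono_fan_power: "strict_mono fan_power"
  by (rule strict_monoI) (use fan_power_slope_ge_1 in \<open>smt (verit)\<close>)

lemma surj_fan_power: "surj fan_power"
proof -
  have "\<exists>x. fan_power x = y" for y
  proof -
    \<comment> \<open>By the slope bound, moving from 0 by \<open>c\<close> changes the power by at
      least the distance from \<open>fan_power 0\<close> to \<open>y\<close>, so \<open>- c\<close>
      and \<open>c\<close> bracket a preimage.\<close>
    define c where "c = \<bar>y - fan_power 0\<bar>"
    have "fan_power (- c) \<le> y" "y \<le> fan_power c"
      using fan_power_slope_ge_1[of 0 c] fan_power_slope_ge_1[of "- c" 0] by (auto simp: c_def)
    moreover have "continuous_on {- c..c} fan_power"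
      unfolding fan_power_def by (intro continuous_intros)
    ultimately show ?thesis
      using IVT'[of fan_power "- c" y c] by (auto simp: c_def)
  qed
  then show ?thesis by (metis surjI)
qed

lemma fan_flow_fan_power [simp]: "fan_flow (fan_power u) = u"
  by (simp add: strict_mono_fan_power strict_mono_imp_inj_on)

lemma fan_flow_le_iff [simp]: "fan_flow p \<le> fan_flow q \<longleftrightarrow> p \<le> q"
  by (metis strict_mono_fan_power strict_mono_less_eq surj_f_inv_f surj_fan_power)

lemma R_up_nonneg: "0 \<le> rd \<Longrightarrow> 0 \<le> R_up u rd"
  using fan_power_slope_ge_1[of "u - rd" u] by (simp add: R_up_def)

lemma R_down_nonneg: "0 \<le> ru \<Longrightarrow> 0 \<le> R_down u ru"
  using fan_power_slope_ge_1[of u "u + ru"] by (simp add: R_down_def)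

text \<open>Both linear branches have nonnegative slope, and they meet at 0; for signals of
  different sign the two requests lie on either side of 0.\<close>

lemma reserve_request_mono:
  assumes "0 \<le> ru" "0 \<le> rd" "v \<le> w"
  shows "reserve_request u ru rd v \<le> reserve_request u ru rd w"
proof -
  have "v * R_up u rd \<le> 0" if "v < 0"
    using that R_up_nonneg[OF assms(2)] by (simp add: mult_nonpos_nonneg)
  moreover have "0 \<le> w * R_down u ru" if "0 \<le> w"
    using that R_down_nonneg[OF assms(1)] by simp
  ultimately show ?thesis
    using assms R_up_nonneg[OF assms(2)] R_down_nonneg[OF assms(1)]
    by (auto simp: reserve_request_def intro: mult_right_mono order_trans)
qed

lemma flow_change_mono:
  assumes "0 \<le> ru" "0 \<le> rd" "v \<le> w"
  shows "flow_change u ru rd v \<le> flow_change u ru rd w"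
  using reserve_request_mono[OF assms] by (simp add: flow_change_def)

lemma flow_change_minus_one: "u + flow_change u ru rd (-1) = u - rd"
  by (simp add: flow_change_def reserve_request_def R_up_def)

lemma flow_change_one: "u + flow_change u ru rd 1 = u + ru"
  by (simp add: flow_change_def reserve_request_def R_down_def)

text \<open>By monotonicity only the signals -1 and 1 matter. There the definitions of
  \<open>R_up\<close> and \<open>R_down\<close> telescope, and \<open>fan_flow\<close> recovers the
  thermal reserves exactly.\<close>

lemma flow_bounds_iff:
  assumes "0 \<le> ru" "0 \<le> rd"
  shows "(\<forall>w\<in>{-1..1}. u_min \<le> u + flow_change u ru rd w \<and> u + flow_change u ru rd w \<le> u_max)
    \<longleftrightarrow> u_min \<le> u - rd \<and> u + ru \<le> u_max" (is "?l \<longleftrightarrow> ?r")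
proof
  assume ?l
  then have "u_min \<le> u + flow_change u ru rd (-1)" "u + flow_change u ru rd 1 \<le> u_max"
    by auto
  then show ?r
    by (simp only: flow_change_minus_one flow_change_one)
next
  assume r: ?r
  show ?l
  proof
    fix w :: real assume "w \<in> {-1..1}"
    then have "flow_change u ru rd (-1) \<le> flow_change u ru rd w"
      "flow_change u ru rd w \<le> flow_change u ru rd 1"
      using assms by (auto intro: flow_change_mono)
    then show "u_min \<le> u + flow_change u ru rd w \<and> u + flow_change u ru rd w \<le> u_max"
      using r flow_change_minus_one[of u ru rd] flow_change_one[of u ru rd] by linarith
  qed
qed

text \<open>Makes the cold trajectory of (Q) one of the scenarios of (P): a positive signal selects
  the \<open>R_down\<close> branch, and \<open>u\<close> cancels.\<close>

lemma lower_trajectory_eq_robust: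
  assumes "0 < w_lim D"
  shows "lower_trajectory D d = robust_trajectory D d (\<lambda>_. w_lim D)"
  using assms
  by (cases d) (simp add: lower_trajectory_def robust_trajectory_def flow_change_def
      reserve_request_def)

lemma upper_trajectory_eq_robust:
  assumes "0 < w_lim D"
  shows "upper_trajectory D d = robust_trajectory D d (\<lambda>_. - w_lim D)"
  using assms
  by (cases d) (simp add: upper_trajectory_def robust_trajectory_def flow_change_def
      reserve_request_def)

text \<open>The bilinear term is merged into the coefficient of the room temperature, whose sign
  decides monotonicity. The disturbance stays opaque, as it cancels in comparisons.\<close>

lemma trajectory_Suc_1:
  "trajectory D q (Suc k) $ 1 =
     (a11 (bmodel D) - bcoef (bmodel D) * q k) * trajectory D q k $ 1
     + a12 (bmodel D) * trajectory D q k $ 2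
     + bcoef (bmodel D) * q k * supply_temp D + (mat_Bv (bmodel D) *v disturbance D k) $ 1"
  by (simp add: mat_A_def vec_Bu_def mat_Bxu_def matrix_vector_mult_def sum_2 algebra_simps)

lemma trajectory_Suc_2:
  "trajectory D q (Suc k) $ 2 =
     a21 (bmodel D) * trajectory D q k $ 1 + a22 (bmodel D) * trajectory D q k $ 2
     + (mat_Bv (bmodel D) *v disturbance D k) $ 2"
  by (simp add: mat_A_def vec_Bu_def mat_Bxu_def matrix_vector_mult_def sum_2 algebra_simps)

text \<open>Numerical check for both parameter sets: \<open>bcoef m * u_max\<close> is about 0.337
  against 0.8665, and about 0.530 against 0.6344.\<close>

lemma building_signs:
  assumes "m \<in> {building_i, building_ii}"
  shows "0 \<le> a12 m" "0 \<le> a21 m" "0 \<le> a22 m" "0 \<le> bcoef m" "bcoef m * u_max \<le> a11 m"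
  using assms by (auto simp: building_i_def building_ii_def u_max_def flow_of_speed_def)

text \<open>The order is componentwise: the induction must carry the mass temperature too, since it
  feeds into the room through \<open>a12\<close>.\<close>

lemma trajectory_antimono_flow:
  assumes building: "bmodel D \<in> {building_i, building_ii}"
    and flow: "\<And>j. j < n \<Longrightarrow> p j \<le> q j" "\<And>j. j < n \<Longrightarrow> p j \<le> u_max"
    and warm: "\<And>j. j < n \<Longrightarrow> supply_temp D \<le> room_temp (trajectory D q j)"
  shows "k \<le> n \<Longrightarrow> trajectory D q k \<le> trajectory D p k"
proof (induction k)
  case 0
  show ?case by simp
next
  case (Suc k)
  let ?m = "bmodel D" and ?x = "trajectory D q k" and ?y = "trajectory D p k"
  note signs = building_signs[OF building]
  have k: "k < n" using Suc.prems by simp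
  have le: "?x $ 1 \<le> ?y $ 1" "?x $ 2 \<le> ?y $ 2"
    using Suc by (auto simp: less_eq_vec_def)
  \<comment> \<open>The comparison goes in two moves: first the state changes from \<open>?x\<close>
    to \<open>?y\<close> at flow \<open>p k\<close>, which needs a nonnegative coefficient.\<close>
  have "bcoef ?m * p k \<le> bcoef ?m * u_max"
    using flow(2)[OF k] signs(4) by (rule mult_left_mono)
  then have "(a11 ?m - bcoef ?m * p k) * ?x $ 1 \<le> (a11 ?m - bcoef ?m * p k) * ?y $ 1"
    using signs(5) le(1) by (intro mult_left_mono) auto
  \<comment> \<open>Second, the flow changes at the fixed state \<open>?x\<close>; this is where the
    warmth of the trajectory under \<open>q\<close> enters.\<close>
  moreover have "bcoef ?m * p k * (?x $ 1 - supply_temp D)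
      \<le> bcoef ?m * q k * (?x $ 1 - supply_temp D)"
    using flow(1)[OF k] warm[OF k] signs(4) by (intro mult_right_mono mult_left_mono) auto
  moreover have "a12 ?m * ?x $ 2 \<le> a12 ?m * ?y $ 2"
    using signs(1) le(2) by (rule mult_left_mono[rotated])
  ultimately have "trajectory D q (Suc k) $ 1 \<le> trajectory D p (Suc k) $ 1"
    unfolding trajectory_Suc_1 by (simp add: algebra_simps)
  moreover have "trajectory D q (Suc k) $ 2 \<le> trajectory D p (Suc k) $ 2"
    unfolding trajectory_Suc_2 using signs le by (intro add_mono mult_left_mono) auto
  ultimately show ?case
    unfolding less_eq_vec_def by (simp only: forall_2)
qed

lemma robust_trajectory_antimono_signal:
  assumes building: "bmodel D \<in> {building_i, building_ii}"
    and reserves: "\<And>j. j < horizon D \<Longrightarrow> 0 \<le> ru j" "\<And>j. j < horizon D \<Longrightarrow> 0 \<le> rd j"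
    and signal: "\<And>j. j < horizon D \<Longrightarrow> v j \<le> w j" "\<And>j. j < horizon D \<Longrightarrow> v j \<le> 1"
    and u_max: "\<And>j. j < horizon D \<Longrightarrow> u j + ru j \<le> u_max"
    and warm: "\<And>j. j < horizon D \<Longrightarrow>
      supply_temp D \<le> room_temp (robust_trajectory D (u, ru, rd) w j)"
    and "k \<le> horizon D"
  shows "robust_trajectory D (u, ru, rd) w k \<le> robust_trajectory D (u, ru, rd) v k"
  unfolding robust_trajectory_def split
proof (rule trajectory_antimono_flow[OF building _ _ _ \<open>k \<le> horizon D\<close>])
  fix j assume j: "j < horizon D"
  note mono = flow_change_mono[OF reserves(1)[OF j] reserves(2)[OF j]]
  show "u j + flow_change (u j) (ru j) (rd j) (v j) \<le> u j + flow_change (u j) (ru j) (rd j) (w j)"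
    using mono signal(1)[OF j] by simp
  show "u j + flow_change (u j) (ru j) (rd j) (v j) \<le> u_max"
    using mono[OF signal(2)[OF j], of "u j"] u_max[OF j] flow_change_one[of "u j" "ru j" "rd j"]
    by linarith
  show "supply_temp D \<le>
      room_temp (trajectory D (\<lambda>k. u k + flow_change (u k) (ru k) (rd k) (w k)) j)"
    using warm[OF j] by (simp add: robust_trajectory_def)
qed

lemma robust_temperature_bounds_iff:
  assumes building: "bmodel D \<in> {building_i, building_ii}"
    and x_min: "\<forall>k<horizon D. supply_temp D \<le> x_min D k"
    and w_lim: "0 < w_lim D" "w_lim D \<le> 1"
    and reserves: "\<And>j. j < horizon D \<Longrightarrow> 0 \<le> ru j" "\<And>j. j < horizon D \<Longrightarrow> 0 \<le> rd j"
    and u_max: "\<And>j. j < horizon D \<Longrightarrow> u j + ru j \<le> u_max"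
  shows "(\<forall>w\<in>signals D. \<forall>k\<le>horizon D.
        x_min D k \<le> room_temp (robust_trajectory D (u, ru, rd) w k)
        \<and> room_temp (robust_trajectory D (u, ru, rd) w k) \<le> x_max D k)
    \<longleftrightarrow> (\<forall>k\<le>horizon D.
        x_min D k \<le> room_temp (lower_trajectory D (u, ru, rd) k)
        \<and> room_temp (upper_trajectory D (u, ru, rd) k) \<le> x_max D k)" (is "?l \<longleftrightarrow> ?r")
proof
  assume ?l
  moreover have "(\<lambda>_. w_lim D) \<in> signals D" "(\<lambda>_. - w_lim D) \<in> signals D"
    using w_lim by (auto simp: signals_def)
  ultimately show ?r
    by (auto simp: lower_trajectory_eq_robust upper_trajectory_eq_robust w_lim(1))
next
  assume r: ?r
  let ?X = "robust_trajectory D (u, ru, rd)"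
  note antimono = robust_trajectory_antimono_signal[where u = u and ru = ru and rd = rd,
    OF building reserves _ _ u_max]
  have lower: "x_min D k \<le> room_temp (?X (\<lambda>_. w_lim D) k)" if "k \<le> horizon D" for k
    using r that by (simp add: lower_trajectory_eq_robust w_lim(1))
  show ?l
  proof (intro ballI allI impI)
    fix w k assume w: "w \<in> signals D" and k: "k \<le> horizon D"
    have w_le: "- w_lim D \<le> w j" "w j \<le> w_lim D" if "j < horizon D" for j
      using w that by (auto simp: signals_def)
    \<comment> \<open>The order of the two comparisons matters. The first one needs warmth of the
      coldest trajectory, which (b') provides since \<open>x_min\<close> is at least the supply
      temperature.\<close>
    have X_ge: "x_min D j \<le> room_temp (?X w j)" if j: "j \<le> horizon D" for j
    proof -
      have "?X (\<lambda>_. w_lim D) j \<le> ?X w j"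
      proof (rule antimono[OF _ _ _ _ _ _ j])
        fix i assume i: "i < horizon D"
        show "w i \<le> 1" using w_le(2)[OF i] w_lim(2) by simp
        show "supply_temp D \<le> room_temp (?X (\<lambda>_. w_lim D) i)"
          using x_min lower[of i] i by fastforce
      qed (use w_le in auto)
      then have "?X (\<lambda>_. w_lim D) j $ 1 \<le> ?X w j $ 1" by (simp add: less_eq_vec_def)
      then show ?thesis using lower[OF j] by simp
    qed
    \<comment> \<open>Here \<open>w\<close> is the larger signal, so its own trajectory must be
      warm, which \<open>X_ge\<close> has just supplied.\<close>
    have "?X w k \<le> ?X (\<lambda>_. - w_lim D) k"
    proof (rule antimono[OF _ _ _ _ _ _ k])
      fix i assume i: "i < horizon D"
      show "supply_temp D \<le> room_temp (?X w i)"
        using x_min X_ge[of i] i by fastforce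
    qed (use w_le w_lim in auto)
    then have "?X w k $ 1 \<le> ?X (\<lambda>_. - w_lim D) k $ 1" by (simp add: less_eq_vec_def)
    moreover have "?X (\<lambda>_. - w_lim D) k $ 1 \<le> x_max D k"
      using r k by (simp add: upper_trajectory_eq_robust w_lim(1))
    ultimately show "x_min D k \<le> room_temp (?X w k) \<and> room_temp (?X w k) \<le> x_max D k"
      using X_ge[OF k] by simp
  qed
qed

theorem proposition1:
  fixes D :: problem_data
  assumes "bmodel D \<in> {building_i, building_ii}"
    and "\<forall>k<horizon D. supply_temp D \<le> x_min D k"
    and "\<forall>d\<in>feasible_set (problem_P D). \<forall>w\<in>signals D. \<forall>k<horizon D.
           x_min D k \<le> room_temp (robust_trajectory D d w k)"
    and "0 < w_lim D" and "w_lim D \<le> 1"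
  shows "equivalent_problems (problem_P D) (problem_Q D)"
proof -
  have "(u, ru, rd) \<in> feasible_set (problem_P D) \<longleftrightarrow> (u, ru, rd) \<in> feasible_set (problem_Q D)"
    for u ru rd
  proof (cases "(u, ru, rd) \<in> decisions D")
    case True
    then have nonneg: "0 \<le> ru j" "0 \<le> rd j" if "j < horizon D" for j
      using that by (auto simp: decisions_def dest: PiE_mem)
    have "(\<forall>k<horizon D. \<forall>w\<in>{-1..1}. u_min \<le> u k + flow_change (u k) (ru k) (rd k) w
          \<and> u k + flow_change (u k) (ru k) (rd k) w \<le> u_max)
        \<longleftrightarrow> (\<forall>k<horizon D. u_min \<le> u k - rd k \<and> u k + ru k \<le> u_max)"
      using nonneg by (simp only: flow_bounds_iff cong: imp_cong)
    \<comment> \<open>The temperature equivalence needs the upper flow bound from (a');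
      \<open>conj_cong\<close> makes that conjunct available while the next one is
      rewritten.\<close>
    then show ?thesis
      using True robust_temperature_bounds_iff[where u = u and ru = ru and rd = rd,
          OF assms(1,2,4,5) nonneg]
      by (simp add: problem_P_def problem_Q_def cong: conj_cong)
  next
    case False
    then show ?thesis by (simp add: problem_P_def problem_Q_def)
  qed
  then have "feasible_set (problem_P D) = feasible_set (problem_Q D)" by auto
  then show ?thesis
    by (simp add: equivalent_problems_def problem_P_def problem_Q_def)
qed

end
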